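(* Let $N\ge1$, $V=\mathbb C^N$, and let $R$ be a rank-$N$ charge-conserving braid representation. (I) If $X$ is an invertible operator on $V\otimes V$ that is diagonal in the basis $(e_i\otimes e_j)_{1\le i,j\le N}$, then $XRX^{-1}$ is also a rank-$N$ charge-conserving braid representation. (II) The relation on rank-$N$ charge-conserving braid representations given by $R\sim R'$ if $R'=XRX^{-1}$ for some such $X$ is an equivalence relation (called X-equivalence).
   Context: Let $V=\mathbb C^N$ have standard basis $e_1,\dots,e_N$. A linear operator $R$ on $V\otimes V$ is charge-conserving if for all $i,j$ the vector $R(e_i\otimes e_j)$ lies in the span of $e_i\otimes e_j$ and $e_j\otimes e_i$. A rank-$N$ charge-conserving braid representation is an invertible charge-conserving $R$ with $(R\otimes 1_V)(1_V\otimes R)(R\otimes 1_V)=(1_V\otimes R)(R\otimes 1_V)(1_V\otimes R)$; equivalently, the image $R=F(\sigma)$ of the elementary braid under a strict monoidal functor $F$ from the braid category to the category of charge-conserving matrices with $F(1)=1$. *)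

theory Defs
  imports "HOL-Analysis.Analysis"
begin

text \<open>
  \<open>V\<close> is \<open>complex ^ 'n\<close>, where the finite index type \<open>'n\<close> has \<open>N = CARD('n) \<ge> 1\<close> elements.
  The tensor product of \<open>complex ^ 'a\<close> and \<open>complex ^ 'b\<close> is \<open>complex ^ ('a \<times> 'b)\<close>.
  The plain constant \<open>linear\<close> of the library is linearity over the reals; operators here are
  linear over the complex numbers, hence \<open>Vector_Spaces.linear (*s) (*s)\<close> and \<open>vec.span\<close>.
\<close>

definition tensor_vec ::
    "complex ^ 'a \<Rightarrow> complex ^ 'b \<Rightarrow> complex ^ ('a \<times> 'b)" (infixr "\<otimes>\<^sub>v" 75) where
  "u \<otimes>\<^sub>v w = (\<chi> p. u $ fst p * w $ snd p)"

definition ebasis :: "'a::finite \<Rightarrow> complex ^ 'a" where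
  "ebasis i = axis i 1"

lemma tensor_vec_ebasis: "ebasis i \<otimes>\<^sub>v ebasis j = ebasis (i, j)"
  by (auto simp: tensor_vec_def ebasis_def axis_def vec_eq_iff)

text \<open>The linear map that sends \<open>ebasis a \<otimes>\<^sub>v ebasis b\<close> to \<open>A (ebasis a) \<otimes>\<^sub>v B (ebasis b)\<close>.\<close>

definition tensor_map ::
    "(complex ^ 'a \<Rightarrow> complex ^ 'c) \<Rightarrow> (complex ^ 'b \<Rightarrow> complex ^ 'd) \<Rightarrow>
     complex ^ ('a::finite \<times> 'b::finite) \<Rightarrow> complex ^ ('c::finite \<times> 'd::finite)"
    (infixr "\<otimes>\<^sub>m" 75) where
  "(A \<otimes>\<^sub>m B) v = (\<Sum>a\<in>UNIV. \<Sum>b\<in>UNIV. v $ (a, b) *s (A (ebasis a) \<otimes>\<^sub>v B (ebasis b)))"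

lemma linear_expand:
  assumes "Vector_Spaces.linear (*s) (*s) (A :: complex ^ 'a::finite \<Rightarrow> complex ^ 'c::finite)"
  shows "A u = (\<Sum>a\<in>UNIV. u $ a *s A (ebasis a))"
proof -
  interpret A: Vector_Spaces.linear "(*s)" "(*s)" A by (fact assms)
  have "A u = A (\<Sum>a\<in>UNIV. u $ a *s ebasis a)"
    unfolding ebasis_def by (simp add: basis_expansion)
  also have "\<dots> = (\<Sum>a\<in>UNIV. u $ a *s A (ebasis a))"
    by (simp add: A.sum A.scale)
  finally show ?thesis .
qed

lemma tensor_map_tensor_vec:
  assumes "Vector_Spaces.linear (*s) (*s) A" "Vector_Spaces.linear (*s) (*s) B"
  shows "(A \<otimes>\<^sub>m B) (u \<otimes>\<^sub>v w) = A u \<otimes>\<^sub>v B w"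
  unfolding linear_expand[OF assms(1), of u] linear_expand[OF assms(2), of w]
  by (simp add: vec_eq_iff tensor_map_def tensor_vec_def sum_product mult_ac)

definition assoc_tensor ::
    "complex ^ (('a::finite \<times> 'b::finite) \<times> 'c::finite) \<Rightarrow> complex ^ ('a \<times> 'b \<times> 'c)" where
  "assoc_tensor v = (\<chi> p. v $ ((fst p, fst (snd p)), snd (snd p)))"

lemma assoc_tensor_tensor_vec: "assoc_tensor ((u \<otimes>\<^sub>v v) \<otimes>\<^sub>v w) = u \<otimes>\<^sub>v v \<otimes>\<^sub>v w"
  by (simp add: assoc_tensor_def tensor_vec_def vec_eq_iff)

lemma bij_assoc_tensor: "bij assoc_tensor"
proof (rule o_bij)
  let ?g = "\<lambda>v. \<chi> p. v $ (fst (fst p), snd (fst p), snd p)"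
  show "?g \<circ> assoc_tensor = id" "assoc_tensor \<circ> ?g = id"
    by (auto simp: fun_eq_iff vec_eq_iff assoc_tensor_def)
qed

text \<open>\<open>R \<otimes> 1\<close> and \<open>1 \<otimes> R\<close>, both acting on \<open>V \<otimes> (V \<otimes> V)\<close>.\<close>

definition R_tensor_one ::
    "(complex ^ ('n \<times> 'n) \<Rightarrow> complex ^ ('n \<times> 'n)) \<Rightarrow>
     complex ^ ('n \<times> 'n \<times> 'n) \<Rightarrow> complex ^ ('n::finite \<times> 'n \<times> 'n)" where
  "R_tensor_one R = assoc_tensor \<circ> (R \<otimes>\<^sub>m id) \<circ> inv assoc_tensor"

definition one_tensor_R ::
    "(complex ^ ('n \<times> 'n) \<Rightarrow> complex ^ ('n \<times> 'n)) \<Rightarrow>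
     complex ^ ('n \<times> 'n \<times> 'n) \<Rightarrow> complex ^ ('n::finite \<times> 'n \<times> 'n)" where
  "one_tensor_R R = id \<otimes>\<^sub>m R"

definition charge_conserving ::
    "(complex ^ ('n \<times> 'n) \<Rightarrow> complex ^ ('n::finite \<times> 'n)) \<Rightarrow> bool" where
  "charge_conserving R \<longleftrightarrow> (\<forall>i j. R (ebasis i \<otimes>\<^sub>v ebasis j)
      \<in> vec.span {ebasis i \<otimes>\<^sub>v ebasis j, ebasis j \<otimes>\<^sub>v ebasis i})"

definition braid_relation ::
    "(complex ^ ('n \<times> 'n) \<Rightarrow> complex ^ ('n::finite \<times> 'n)) \<Rightarrow> bool" where
  "braid_relation R \<longleftrightarrow>
     R_tensor_one R \<circ> one_tensor_R R \<circ> R_tensor_one R =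
     one_tensor_R R \<circ> R_tensor_one R \<circ> one_tensor_R R"

definition cc_braid_rep ::
    "(complex ^ ('n \<times> 'n) \<Rightarrow> complex ^ ('n::finite \<times> 'n)) \<Rightarrow> bool" where
  "cc_braid_rep R \<longleftrightarrow> Vector_Spaces.linear (*s) (*s) R \<and> bij R \<and>
     charge_conserving R \<and> braid_relation R"

definition invertible_diagonal ::
    "(complex ^ ('n \<times> 'n) \<Rightarrow> complex ^ ('n::finite \<times> 'n)) \<Rightarrow> bool" where
  "invertible_diagonal X \<longleftrightarrow> Vector_Spaces.linear (*s) (*s) X \<and> bij X \<and>
     (\<forall>i j. \<exists>c. X (ebasis i \<otimes>\<^sub>v ebasis j) = c *s (ebasis i \<otimes>\<^sub>v ebasis j))"

definition X_equivalence ::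
    "(complex ^ ('n \<times> 'n) \<Rightarrow> complex ^ ('n::finite \<times> 'n)) rel" where
  "X_equivalence = {(R, R'). cc_braid_rep R \<and> cc_braid_rep R' \<and>
     (\<exists>X. invertible_diagonal X \<and> R' = X \<circ> R \<circ> inv X)}"

end

theory Submission
  imports Defs
begin

text \<open>
  If \<open>X\<close> has eigenvalue \<open>x\<^sub>i\<^sub>j\<close> on \<open>e\<^sub>i \<otimes> e\<^sub>j\<close>, let \<open>D\<close> be the diagonal operator on \<open>V \<otimes> V \<otimes> V\<close>
  with eigenvalue \<open>x\<^sub>i\<^sub>j x\<^sub>i\<^sub>k x\<^sub>j\<^sub>k\<close> on \<open>e\<^sub>i \<otimes> e\<^sub>j \<otimes> e\<^sub>k\<close>. The ratio of the eigenvalues of \<open>D\<close> at two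
  basis vectors that differ by a swap of neighbouring factors is the corresponding ratio for \<open>X\<close>, so
  for a charge-conserving \<open>R\<close> conjugation by \<open>D\<close> turns \<open>R \<otimes> 1\<close> and \<open>1 \<otimes> R\<close> simultaneously into
  \<open>X R X\<^sup>-\<^sup>1 \<otimes> 1\<close> and \<open>1 \<otimes> X R X\<^sup>-\<^sup>1\<close>. Hence the braid relation is preserved.
\<close>

section \<open>Diagonal operators and their eigenvalues\<close>

definition diag_op :: "('a \<Rightarrow> complex) \<Rightarrow> complex ^ 'a \<Rightarrow> complex ^ 'a" where
  "diag_op x v = (\<chi> p. x p * v $ p)"

lemma diag_op_nth [simp]: "diag_op x v $ p = x p * v $ p"
  by (simp add: diag_op_def)

lemma linear_diag_op: "Vector_Spaces.linear (*s) (*s) (diag_op x)"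
  by unfold_locales (simp_all add: vec_eq_iff algebra_simps)

lemma diag_op_comp: "diag_op x \<circ> diag_op y = diag_op (\<lambda>p. x p * y p)"
  by (simp add: fun_eq_iff vec_eq_iff mult.assoc)

lemma diag_op_one: "diag_op (\<lambda>p. 1) = id"
  by (simp add: fun_eq_iff vec_eq_iff)

lemma diag_op_inverse:
  assumes "\<And>p. x p \<noteq> 0"
  shows "diag_op x \<circ> diag_op (\<lambda>p. inverse (x p)) = id"
    and "diag_op (\<lambda>p. inverse (x p)) \<circ> diag_op x = id"
  using assms by (simp_all add: diag_op_comp diag_op_one)

lemma bij_diag_op: "(\<And>p. x p \<noteq> 0) \<Longrightarrow> bij (diag_op x)"
  by (rule o_bij[OF diag_op_inverse(2,1)])

lemma inv_diag_op:
  "(\<And>p. x p \<noteq> 0) \<Longrightarrow> inv (diag_op x) = diag_op (\<lambda>p. inverse (x p))"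
  by (rule inv_unique_comp[OF diag_op_inverse])

lemma ebasis_nth: "ebasis i $ j = (if j = i then 1 else 0)"
  by (simp add: ebasis_def axis_def)

lemma diag_op_ebasis: "diag_op x (ebasis p) = x p *s ebasis p"
  by (simp add: vec_eq_iff ebasis_nth)

text \<open>A linear map is determined by its values on the basis, so choosing an eigenvalue for
  each basis vector recovers \<open>X\<close>. Injectivity excludes the eigenvalue 0; conversely,
  nonzero eigenvalues can be inverted pointwise.\<close>

lemma invertible_diagonal_iff:
  "invertible_diagonal X \<longleftrightarrow> (\<exists>x. (\<forall>p. x p \<noteq> 0) \<and> X = diag_op x)"
proof
  assume "invertible_diagonal X"
  then have lin: "Vector_Spaces.linear (*s) (*s) X" and "bij X"
    and "\<forall>p. \<exists>c. X (ebasis p) = c *s ebasis p"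
    by (auto simp: invertible_diagonal_def tensor_vec_ebasis)
  then obtain x where x: "\<And>p. X (ebasis p) = x p *s ebasis p"
    by metis
  interpret X: Vector_Spaces.linear "(*s)" "(*s)" X by (fact lin)
  have "X v = diag_op x v" for v
    using linear_expand[OF lin, of v] linear_expand[OF linear_diag_op, of x v]
    by (simp add: x diag_op_ebasis)
  moreover have "x p \<noteq> 0" for p
  proof
    assume "x p = 0"
    then have "X (ebasis p) = X 0" by (simp add: x X.zero)
    then have "ebasis p = 0" by (rule injD[OF bij_is_inj[OF \<open>bij X\<close>]])
    then show False by (simp add: ebasis_def)
  qed
  ultimately show "\<exists>x. (\<forall>p. x p \<noteq> 0) \<and> X = diag_op x" by blast
next
  assume "\<exists>x. (\<forall>p. x p \<noteq> 0) \<and> X = diag_op x"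
  then obtain x where nz: "\<And>p. x p \<noteq> 0" and X: "X = diag_op x" by blast
  have "bij X" unfolding X by (rule bij_diag_op) (fact nz)
  then show "invertible_diagonal X"
    by (auto simp: invertible_diagonal_def X tensor_vec_ebasis diag_op_ebasis linear_diag_op)
qed

section \<open>Charge-conserving operators in coordinates\<close>

text \<open>The indices of \<open>a\<close> and \<open>b\<close> are those of the output coordinate:
  for distinct \<open>i\<close> and \<open>j\<close>, \<open>b i j\<close> is the coefficient of
  \<open>ebasis (i, j)\<close> in the image of \<open>ebasis (j, i)\<close>. For
  \<open>i = j\<close> only the sum \<open>a i i + b i i\<close> is determined by
  \<open>R\<close>.\<close>

definition cc_coeffs ::
  "(complex ^ ('n::finite \<times> 'n) \<Rightarrow> complex ^ ('n \<times> 'n)) \<Rightarrow> ('n \<Rightarrow> 'n \<Rightarrow> complex) \<Rightarrow>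
   ('n \<Rightarrow> 'n \<Rightarrow> complex) \<Rightarrow> bool" where
  "cc_coeffs R a b \<longleftrightarrow>
     (\<forall>w i j. R w $ (i, j) = a i j * w $ (i, j) + b i j * w $ (j, i))"

lemma span_pair_iff:
  fixes u v w :: "complex ^ 'a"
  shows "w \<in> vec.span {u, v} \<longleftrightarrow> (\<exists>s t. w = s *s u + t *s v)"
  by (simp add: vec.span_breakdown_eq[of w u] vec.span_singleton image_iff diff_eq_eq add.commute)

lemma charge_conserving_iff:
  fixes R :: "complex ^ ('n::finite \<times> 'n) \<Rightarrow> complex ^ ('n \<times> 'n)"
  assumes lin: "Vector_Spaces.linear (*s) (*s) R"
  shows "charge_conserving R \<longleftrightarrow> (\<exists>a b. cc_coeffs R a b)"
proof
  assume "charge_conserving R"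
  then have "\<forall>i j. \<exists>s t. R (ebasis (i, j)) = s *s ebasis (i, j) + t *s ebasis (j, i)"
    by (simp add: charge_conserving_def tensor_vec_ebasis span_pair_iff)
  then obtain s t where st:
    "\<And>i j. R (ebasis (i, j)) = s i j *s ebasis (i, j) + t i j *s ebasis (j, i)"
    by metis
  \<comment> \<open>The indices of \<open>t\<close> are transposed because \<open>t\<close> is
    indexed by the input vector: the swapped contribution to coordinate \<open>(i, j)\<close> comes
    from \<open>ebasis (j, i)\<close>.\<close>
  have "R w $ (i, j) = s i j * w $ (i, j) + t j i * w $ (j, i)" for w i j
  proof -
    have "R w $ (i, j) = (\<Sum>p\<in>UNIV. w $ p * R (ebasis p) $ (i, j))"
      by (subst linear_expand[OF lin]) simp
    also have "\<dots> = (\<Sum>p\<in>UNIV. (if p = (i, j) then s i j * w $ p else 0)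
                           + (if p = (j, i) then t j i * w $ p else 0))"
    proof (rule sum.cong)
      fix p :: "'n \<times> 'n"
      obtain k l where "p = (k, l)" by (cases p)
      show "w $ p * R (ebasis p) $ (i, j) = (if p = (i, j) then s i j * w $ p else 0)
                           + (if p = (j, i) then t j i * w $ p else 0)"
        \<comment> \<open>The diagonal and the swapped term are matched separately, so the case
          \<open>i = j\<close>, where both contribute, needs no special treatment.\<close>
        unfolding \<open>p = (k, l)\<close> st vector_add_component vector_smult_component distrib_left
        by (rule arg_cong2[of _ _ _ _ "(+)"]) (auto simp: ebasis_nth)
    qed simp
    finally show ?thesis by (simp add: sum.distrib)
  qed
  then have "cc_coeffs R s (\<lambda>i j. t j i)" by (simp add: cc_coeffs_def)
  then show "\<exists>a b. cc_coeffs R a b" by blast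
next
  assume "\<exists>a b. cc_coeffs R a b"
  then obtain a b where "cc_coeffs R a b" by blast
  then have R: "R w $ (k, l) = a k l * w $ (k, l) + b k l * w $ (l, k)" for w k l
    by (simp add: cc_coeffs_def)
  have "R (ebasis (i, j)) $ (k, l) =
      (a i j *s ebasis (i, j) + b j i *s ebasis (j, i)) $ (k, l)" for i j k l
    unfolding R vector_add_component vector_smult_component
    by (rule arg_cong2[of _ _ _ _ "(+)"]) (auto simp: ebasis_nth)
  then have "R (ebasis (i, j)) = a i j *s ebasis (i, j) + b j i *s ebasis (j, i)" for i j
    unfolding vec_eq_iff split_paired_All by blast
  then show "charge_conserving R"
    unfolding charge_conserving_def tensor_vec_ebasis span_pair_iff by blast
qed

text \<open>The eigenvalues cancel in the diagonal term; the swapped term enters at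
  \<open>(j, i)\<close> and leaves at \<open>(i, j)\<close>, which gives the ratio of the two
  eigenvalues.\<close>

lemma cc_coeffs_conj:
  assumes "cc_coeffs R a b" "\<And>p. x p \<noteq> 0"
  shows "cc_coeffs (diag_op x \<circ> R \<circ> diag_op (\<lambda>p. inverse (x p))) a
           (\<lambda>i j. b i j * x (i, j) * inverse (x (j, i)))"
  using assms by (simp add: cc_coeffs_def field_simps)

section \<open>The two actions on the triple tensor product\<close>

lemma inv_assoc_tensor_nth [simp]: "inv assoc_tensor v $ ((i, j), k) = v $ (i, j, k)"
proof -
  have "assoc_tensor (inv assoc_tensor v) $ (i, j, k) = v $ (i, j, k)"
    by (simp add: bij_assoc_tensor bij_is_surj surj_f_inv_f)
  then show ?thesis by (simp add: assoc_tensor_def)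
qed

lemma R_tensor_one_nth:
  fixes R :: "complex ^ ('n::finite \<times> 'n) \<Rightarrow> complex ^ ('n \<times> 'n)"
  assumes "Vector_Spaces.linear (*s) (*s) R" "cc_coeffs R a b"
  shows "R_tensor_one R v $ (i, j, k) = a i j * v $ (i, j, k) + b i j * v $ (j, i, k)"
proof -
  \<comment> \<open>The third factor is untouched, so \<open>R\<close> acts on the slice of
    \<open>v\<close> with last index \<open>k\<close>.\<close>
  let ?w = "\<chi> p. v $ (fst p, snd p, k)"
  have "R_tensor_one R v $ (i, j, k) =
      (\<Sum>p\<in>UNIV. \<Sum>c\<in>UNIV. if k = c then ?w $ p * R (ebasis p) $ (i, j) else 0)"
    unfolding R_tensor_one_def
    by (auto simp: assoc_tensor_def tensor_map_def tensor_vec_def ebasis_nth[of _ k]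
        mult_delta_right intro!: sum.cong)
  also have "\<dots> = R ?w $ (i, j)"
    by (subst linear_expand[OF assms(1), of ?w]) simp
  finally show ?thesis using assms(2) by (simp add: cc_coeffs_def)
qed

lemma one_tensor_R_nth:
  fixes R :: "complex ^ ('n::finite \<times> 'n) \<Rightarrow> complex ^ ('n \<times> 'n)"
  assumes "Vector_Spaces.linear (*s) (*s) R" "cc_coeffs R a b"
  shows "one_tensor_R R v $ (i, j, k) = a j k * v $ (i, j, k) + b j k * v $ (i, k, j)"
proof -
  let ?w = "\<chi> p. v $ (i, p)"
  have "one_tensor_R R v $ (i, j, k) =
      (\<Sum>c\<in>UNIV. \<Sum>p\<in>UNIV. if i = c then ?w $ p * R (ebasis p) $ (j, k) else 0)"
    unfolding one_tensor_R_def
    by (auto simp: tensor_map_def tensor_vec_def ebasis_nth[of _ i] intro!: sum.cong)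
  also have "\<dots> = R ?w $ (j, k)"
    by (subst sum.swap, subst linear_expand[OF assms(1), of ?w]) simp
  finally show ?thesis using assms(2) by (simp add: cc_coeffs_def)
qed

section \<open>Conjugation and the braid relation\<close>

lemma linear_conj_diag_op:
  assumes "Vector_Spaces.linear (*s) (*s) R"
  shows "Vector_Spaces.linear (*s) (*s) (diag_op x \<circ> R \<circ> diag_op y)"
  by (rule Vector_Spaces.linear_compose[OF linear_diag_op
        Vector_Spaces.linear_compose[OF assms linear_diag_op]])

context
  fixes R :: "complex ^ ('n::finite \<times> 'n) \<Rightarrow> complex ^ ('n \<times> 'n)"
    and x :: "'n \<times> 'n \<Rightarrow> complex" and a b
  assumes lin: "Vector_Spaces.linear (*s) (*s) R"
    and coeffs: "cc_coeffs R a b"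
    and nz: "\<And>p. x p \<noteq> 0"
begin

private definition "R' = diag_op x \<circ> R \<circ> diag_op (\<lambda>p. inverse (x p))"
private definition "d = (\<lambda>(i, j, k). x (i, j) * x (i, k) * x (j, k))"

private lemmas lin' =
  linear_conj_diag_op[OF lin, of x "\<lambda>p. inverse (x p)", folded R'_def]
private lemmas coeffs' = cc_coeffs_conj[where x = x, OF coeffs nz, folded R'_def]

private lemma d_nz: "d p \<noteq> 0"
  using nz by (simp add: d_def split: prod.splits)

text \<open>Swapping \<open>i\<close> and \<open>j\<close> only permutes the factors
  \<open>x (i, k)\<close> and \<open>x (j, k)\<close> of \<open>d\<close>, leaving the ratio of
  \<open>x (i, j)\<close> to \<open>x (j, i)\<close> found in the coefficients of \<open>R'\<close>.
  The intertwining form avoids the inverse of \<open>diag_op d\<close>.\<close>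

private lemma R_tensor_one_conj: "R_tensor_one R' \<circ> diag_op d = diag_op d \<circ> R_tensor_one R"
  using nz
  by (auto simp: fun_eq_iff vec_eq_iff d_def field_simps
      R_tensor_one_nth[OF lin coeffs] R_tensor_one_nth[OF lin' coeffs'])

text \<open>Here the swap of \<open>j\<close> and \<open>k\<close> permutes \<open>x (i, j)\<close>
  and \<open>x (i, k)\<close>, and only \<open>x (j, k)\<close> changes.\<close>

private lemma one_tensor_R_conj: "one_tensor_R R' \<circ> diag_op d = diag_op d \<circ> one_tensor_R R"
  using nz
  by (auto simp: fun_eq_iff vec_eq_iff d_def field_simps
      one_tensor_R_nth[OF lin coeffs] one_tensor_R_nth[OF lin' coeffs'])

lemma braid_relation_conj:
  assumes "braid_relation R"
  shows "braid_relation (diag_op x \<circ> R \<circ> diag_op (\<lambda>p. inverse (x p)))"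
proof -
  let ?A = "R_tensor_one R" and ?B = "one_tensor_R R"
  let ?A' = "R_tensor_one R'" and ?B' = "one_tensor_R R'"
  have A: "?A' (diag_op d v) = diag_op d (?A v)" for v
    using R_tensor_one_conj by (simp add: fun_eq_iff)
  have B: "?B' (diag_op d v) = diag_op d (?B v)" for v
    using one_tensor_R_conj by (simp add: fun_eq_iff)
  have "(?A' \<circ> ?B' \<circ> ?A') \<circ> diag_op d = diag_op d \<circ> (?A \<circ> ?B \<circ> ?A)"
    by (simp add: fun_eq_iff A B)
  also have "\<dots> = diag_op d \<circ> (?B \<circ> ?A \<circ> ?B)"
    using assms by (simp add: braid_relation_def)
  also have "\<dots> = (?B' \<circ> ?A' \<circ> ?B') \<circ> diag_op d"
    by (simp add: fun_eq_iff A B)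
  finally have eq: "?A' \<circ> ?B' \<circ> ?A' \<circ> diag_op d = ?B' \<circ> ?A' \<circ> ?B' \<circ> diag_op d" .
  have "?A' \<circ> ?B' \<circ> ?A' = ?B' \<circ> ?A' \<circ> ?B'"
  proof
    fix v
    \<comment> \<open>Surjectivity of \<open>diag_op d\<close> lets it be cancelled on the
      right.\<close>
    obtain u where "v = diag_op d u"
      using bij_diag_op[of d, OF d_nz] by (blast dest: bij_is_surj surjD)
    then show "(?A' \<circ> ?B' \<circ> ?A') v = (?B' \<circ> ?A' \<circ> ?B') v"
      using fun_cong[OF eq, of u] by simp
  qed
  then show ?thesis by (simp add: braid_relation_def R'_def)
qed

end

lemma cc_braid_rep_conj:
  assumes R: "cc_braid_rep R" and X: "invertible_diagonal X"
  shows "cc_braid_rep (X \<circ> R \<circ> inv X)"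
proof -
  obtain x where nz: "\<And>p. x p \<noteq> 0" and x: "X = diag_op x"
    using X by (auto simp: invertible_diagonal_iff)
  have lin: "Vector_Spaces.linear (*s) (*s) R"
    using R by (simp add: cc_braid_rep_def)
  then obtain a b where coeffs: "cc_coeffs R a b"
    using R by (auto simp: cc_braid_rep_def charge_conserving_iff)
  note lin' = linear_conj_diag_op[OF lin, of x "\<lambda>p. inverse (x p)"]
  show ?thesis
    unfolding x inv_diag_op[OF nz] cc_braid_rep_def charge_conserving_iff[OF lin']
    using R lin' cc_coeffs_conj[where x = x, OF coeffs nz]
      braid_relation_conj[where x = x, OF lin coeffs nz]
    by (auto simp: cc_braid_rep_def nz intro!: bij_comp bij_diag_op)
qed

section \<open>X-equivalence as an equivalence relation\<close>

lemma invertible_diagonal_diag_op: "(\<And>p. x p \<noteq> 0) \<Longrightarrow> invertible_diagonal (diag_op x)"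
  unfolding invertible_diagonal_iff by blast

lemma invertible_diagonal_id: "invertible_diagonal id"
  unfolding diag_op_one[symmetric] by (rule invertible_diagonal_diag_op) simp

lemma invertible_diagonal_inv:
  assumes "invertible_diagonal X"
  shows "invertible_diagonal (inv X)"
proof -
  obtain x where nz: "\<And>p. x p \<noteq> 0" and X: "X = diag_op x"
    using assms unfolding invertible_diagonal_iff by blast
  show ?thesis
    unfolding X inv_diag_op[OF nz] by (rule invertible_diagonal_diag_op) (simp add: nz)
qed

lemma invertible_diagonal_comp:
  assumes "invertible_diagonal X" "invertible_diagonal Y"
  shows "invertible_diagonal (X \<circ> Y)"
proof -
  obtain x y where nz: "\<And>p. x p \<noteq> 0" "\<And>p. y p \<noteq> 0" and XY: "X = diag_op x" "Y = diag_op y"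
    using assms unfolding invertible_diagonal_iff by blast
  show ?thesis
    unfolding XY diag_op_comp by (rule invertible_diagonal_diag_op) (simp add: nz)
qed

text \<open>Invertible diagonal operators contain the identity and are closed under inverse and
  composition; these three facts give reflexivity, symmetry and transitivity of conjugacy.\<close>

lemma equiv_X_equivalence:
  "equiv {R :: complex ^ ('n::finite \<times> 'n) \<Rightarrow> complex ^ ('n \<times> 'n). cc_braid_rep R} X_equivalence"
    (is "equiv ?S ?E")
proof (rule equivI)
  show "?E \<subseteq> ?S \<times> ?S"
    by (auto simp: X_equivalence_def)
  show "refl_on ?S ?E"
  proof (rule refl_onI)
    fix R :: "complex ^ ('n \<times> 'n) \<Rightarrow> complex ^ ('n \<times> 'n)"
    assume "R \<in> ?S"
    moreover have "R = id \<circ> R \<circ> inv id" by simp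
    ultimately show "(R, R) \<in> ?E"
      using invertible_diagonal_id unfolding X_equivalence_def by blast
  qed
  show "sym ?E"
  proof (rule symI)
    fix R R' :: "complex ^ ('n \<times> 'n) \<Rightarrow> complex ^ ('n \<times> 'n)"
    assume "(R, R') \<in> ?E"
    then obtain X where reps: "cc_braid_rep R" "cc_braid_rep R'"
      and X: "invertible_diagonal X" and R': "R' = X \<circ> R \<circ> inv X"
      by (auto simp: X_equivalence_def)
    have "bij X" using X by (simp add: invertible_diagonal_def)
    then have "R = inv X \<circ> R' \<circ> inv (inv X)"
      by (simp add: R' fun_eq_iff inv_inv_eq bij_is_inj)
    with reps X show "(R', R) \<in> ?E"
      by (auto simp: X_equivalence_def intro: invertible_diagonal_inv)
  qed
  show "trans ?E"
  proof (rule transI)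
    fix R R' R'' :: "complex ^ ('n \<times> 'n) \<Rightarrow> complex ^ ('n \<times> 'n)"
    assume "(R, R') \<in> ?E" "(R', R'') \<in> ?E"
    then obtain X Y where reps: "cc_braid_rep R" "cc_braid_rep R''"
      and XY: "invertible_diagonal X" "invertible_diagonal Y"
      and R'': "R'' = Y \<circ> (X \<circ> R \<circ> inv X) \<circ> inv Y"
      by (auto simp: X_equivalence_def)
    have "bij X" "bij Y" using XY by (simp_all add: invertible_diagonal_def)
    \<comment> \<open>Inversion reverses the order of composition, so the two successive
      conjugations merge into one by \<open>Y \<circ> X\<close>.\<close>
    then have "R'' = (Y \<circ> X) \<circ> R \<circ> inv (Y \<circ> X)"
      by (simp add: R'' o_inv_distrib o_assoc)
    with reps XY show "(R, R'') \<in> ?E"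
      by (auto simp: X_equivalence_def intro: invertible_diagonal_comp)
  qed
qed

theorem lemma3p14:
  shows "(\<forall>(R :: complex ^ ('n::finite \<times> 'n) \<Rightarrow> complex ^ ('n \<times> 'n)) X.
            cc_braid_rep R \<longrightarrow> invertible_diagonal X \<longrightarrow> cc_braid_rep (X \<circ> R \<circ> inv X)) \<and>
         equiv {R :: complex ^ ('n \<times> 'n) \<Rightarrow> complex ^ ('n \<times> 'n). cc_braid_rep R} X_equivalence"
  using cc_braid_rep_conj equiv_X_equivalence by blast

end
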